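(* Let $n\ge 1$, let $K,L\in\mathcal{K}^n_0$, let $p,q\in[-\infty,\infty]$ with $p<q$, and let $M_p\in\{\overline{M}_p,\underline{M}_p\}$, $M_q\in\{\overline{M}_q,\underline{M}_q\}$. Then the following are equivalent: (i) $M_p(K,L)=M_q(K,L)$. (ii) $K=L$.
   Context: $\mathcal{K}^n_0$ denotes the set of compact convex subsets of $\mathbb{R}^n$ containing the origin in their interior. For $C\in\mathcal{K}^n_0$, $h_C(a)=\sup\{a^Tx : x\in C\}$ is the support function and $\|x\|_C=\inf\{\lambda\ge 0 : x\in\lambda C\}$ the gauge function. For $x,y>0$, $m_p(x,y)=\left(\frac{x^p+y^p}{2}\right)^{1/p}$ if $p\in\mathbb{R}\setminus\{0\}$, $m_0(x,y)=\sqrt{xy}$, $m_{-\infty}(x,y)=\min\{x,y\}$, $m_\infty(x,y)=\max\{x,y\}$. $\mathbb{S}_2$ is the Euclidean unit sphere in $\mathbb{R}^n$. For $K,L\in\mathcal{K}^n_0$ and $p\in[-\infty,\infty]$, the upper $p$-mean is \[ \overline{M}_p(K,L)=\{x\in\mathbb{R}^n : a^Tx\le m_p(h_K(a),h_L(a)) \text{ for all } a\in\mathbb{S}_2\}, \] and the lower $p$-mean is \[ \underline{M}_p(K,L)=\mathrm{conv}\left(\left\{m_p(\|v\|_K^{-1},\|v\|_L^{-1})\,v : v\in\mathbb{S}_2\right\}\right). \] *)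

theory Defs
  imports "HOL-Analysis.Analysis"
begin

definition convex_bodies0 :: "(real ^ 'n) set set" where
  "convex_bodies0 = {C. compact C \<and> convex C \<and> 0 \<in> interior C}"

definition support_fun :: "(real ^ 'n) set \<Rightarrow> real ^ 'n \<Rightarrow> real" where
  "support_fun C a = (SUP x\<in>C. a \<bullet> x)"

text \<open>The Minkowski functional of \<open>C\<close>, unrelated to the gauges of Henstock--Kurzweil integration.\<close>

definition gauge_fun :: "(real ^ 'n) set \<Rightarrow> real ^ 'n \<Rightarrow> real" where
  "gauge_fun C x = Inf {l. 0 \<le> l \<and> x \<in> (\<lambda>y. l *\<^sub>R y) ` C}"

text \<open>Only the values at \<open>x > 0\<close> and \<open>y > 0\<close> are meaningful.\<close>

definition pmean :: "ereal \<Rightarrow> real \<Rightarrow> real \<Rightarrow> real" where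
  "pmean p x y =
    (if p = -\<infinity> then min x y
     else if p = \<infinity> then max x y
     else if p = 0 then sqrt (x * y)
     else ((x powr real_of_ereal p + y powr real_of_ereal p) / 2) powr (1 / real_of_ereal p))"

definition upper_mean :: "ereal \<Rightarrow> (real ^ 'n) set \<Rightarrow> (real ^ 'n) set \<Rightarrow> (real ^ 'n) set" where
  "upper_mean p K L =
    {x. \<forall>a\<in>sphere 0 1. a \<bullet> x \<le> pmean p (support_fun K a) (support_fun L a)}"

definition lower_mean :: "ereal \<Rightarrow> (real ^ 'n) set \<Rightarrow> (real ^ 'n) set \<Rightarrow> (real ^ 'n) set" where
  "lower_mean p K L =
    convex hull ((\<lambda>v. pmean p (inverse (gauge_fun K v)) (inverse (gauge_fun L v)) *\<^sub>R v) ` sphere 0 1)"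

end

theory Submission
  imports Defs
begin

text \<open>
  For equal exponents the lower mean lies in the upper mean: a point \<open>m\<^sub>p(\<rho>\<^sub>K(v), \<rho>\<^sub>L(v)) v\<close> of the
  lower mean satisfies every inequality defining the upper mean, because \<open>m\<^sub>p\<close> is monotone and
  homogeneous and \<open>\<rho>\<^sub>C(v) v\<close> lies in \<open>C\<close>, where \<open>\<rho>\<^sub>C\<close> is the reciprocal of the gauge. Hence an
  equality between a \<open>p\<close>-mean and a \<open>q\<close>-mean, whichever of the two kinds each of them is, forces
  the lower \<open>q\<close>-mean into the upper \<open>p\<close>-mean. By \<open>lower_mean_not_subset\<close>
  this is impossible if \<open>K \<noteq> L\<close> and \<open>p < q\<close>.

  To see the impossibility, let \<open>L\<close> not be contained in \<open>K\<close> (the means are symmetric), and let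
  \<open>R > 1\<close> be the smallest factor with \<open>L \<subseteq> R K\<close>. Then \<open>L\<close> touches the boundary of \<open>R K\<close> at a point
  \<open>R k\<close>. For an outer unit normal \<open>a\<close> of \<open>K\<close> at \<open>k\<close> and for the direction \<open>v\<close> of \<open>k\<close>,
  the ratio of the radial functions at \<open>v\<close> and the ratio of the support functions at \<open>a\<close> are both
  equal to \<open>R\<close>. So the point \<open>x\<close> of the lower \<open>q\<close>-mean in direction \<open>v\<close> has
  \<open>a \<bullet> x = m\<^sub>q(h\<^sub>K(a), h\<^sub>L(a))\<close>, which exceeds \<open>m\<^sub>p(h\<^sub>K(a), h\<^sub>L(a))\<close> by the strict power mean
  inequality, since \<open>h\<^sub>K(a) \<noteq> h\<^sub>L(a)\<close>. Hence \<open>x\<close> violates the inequality of the upper \<open>p\<close>-mean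
  for \<open>a\<close>.

  Conversely, \<open>m\<^sub>p(x, x) = x\<close>, so every mean of \<open>K\<close> with itself is \<open>K\<close>: the upper mean is the
  intersection of the supporting halfspaces, and the lower mean contains every chord through \<open>0\<close>.
\<close>

section \<open>Power means of two positive numbers\<close>

lemma pmean_real:
  assumes "r \<noteq> 0"
  shows "pmean (ereal r) x y = ((x powr r + y powr r) / 2) powr (1 / r)"
  using assms by (simp add: pmean_def)

lemma pmean_cases [case_names MInf PInf zero real]:
  fixes p :: ereal
  assumes "p = -\<infinity> \<Longrightarrow> P" "p = \<infinity> \<Longrightarrow> P" "p = 0 \<Longrightarrow> P" "\<And>r. r \<noteq> 0 \<Longrightarrow> p = ereal r \<Longrightarrow> P"
  shows P
  using assms by (cases p) (auto simp: zero_ereal_def)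

lemma pmean_pos:
  assumes "0 < x" "0 < y"
  shows "0 < pmean p x y"
proof (cases p rule: pmean_cases)
  case (real r)
  have "0 < x powr r + y powr r"
    using assms by (intro add_pos_pos) auto
  then show ?thesis using real by (simp add: pmean_real)
qed (use assms in \<open>auto simp: pmean_def\<close>)

lemma pmean_same:
  assumes "0 < x"
  shows "pmean p x x = x"
proof (cases p rule: pmean_cases)
  case (real r)
  then show ?thesis using assms by (simp add: pmean_real powr_powr)
qed (use assms in \<open>auto simp: pmean_def\<close>)

lemma pmean_commute: "pmean p x y = pmean p y x"
  by (simp add: pmean_def min.commute max.commute mult.commute add.commute)

lemma pmean_scale:
  assumes "0 < c" "0 < x" "0 < y"
  shows "pmean p (c * x) (c * y) = c * pmean p x y"
proof (cases p rule: pmean_cases)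
  case (real r)
  have factor: "((c * x) powr r + (c * y) powr r) / 2 = c powr r * ((x powr r + y powr r) / 2)"
    using assms by (simp add: powr_mult field_simps)
  have "pmean p (c * x) (c * y) = (c powr r * ((x powr r + y powr r) / 2)) powr (1 / r)"
    unfolding real(2) pmean_real[OF real(1)] factor ..
  also have "\<dots> = (c powr r) powr (1 / r) * pmean p x y"
    unfolding real(2) pmean_real[OF real(1)] powr_mult ..
  finally show ?thesis using assms real by (simp add: powr_powr)
next
  case zero
  have "(c * x) * (c * y) = c\<^sup>2 * (x * y)" by (simp add: power2_eq_square)
  then show ?thesis using assms zero by (simp add: pmean_def real_sqrt_mult)
qed (use assms in \<open>auto simp: pmean_def min_def max_def\<close>)

lemma pmean_mono:
  assumes "0 < x" "x \<le> x'" "0 < y" "y \<le> y'"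
  shows "pmean p x y \<le> pmean p x' y'"
proof (cases p rule: pmean_cases)
  case (real r)
  show ?thesis
  proof (cases "0 < r")
    case True
    then show ?thesis using assms real
      by (auto simp: pmean_real intro!: powr_mono2 add_mono divide_right_mono)
  next
    case False
    have "x' powr r \<le> x powr r" "y' powr r \<le> y powr r"
      using assms False real by (auto intro!: powr_mono2')
    moreover have "0 < x' powr r + y' powr r"
      using assms by (intro add_pos_pos) auto
    ultimately show ?thesis using False real
      by (auto simp: pmean_real intro!: powr_mono2')
  qed
next
  case zero
  then show ?thesis using assms by (auto simp: pmean_def intro!: mult_mono)
qed (use assms in \<open>auto simp: pmean_def\<close>)

text \<open>Reciprocals exchange the exponents \<open>p\<close> and \<open>-p\<close>; this transfers the power mean
  inequality from nonnegative to nonpositive exponents.\<close>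

lemma pmean_uminus:
  assumes "0 < x" "0 < y"
  shows "pmean (- p) x y = inverse (pmean p (inverse x) (inverse y))"
proof (cases p rule: pmean_cases)
  case (real r)
  then have "pmean (- p) x y = ((x powr (- r) + y powr (- r)) / 2) powr (- (1 / r))"
    using pmean_real[of "- r" x y] by simp
  also have "\<dots> = inverse (pmean p (inverse x) (inverse y))"
    using assms real by (simp add: pmean_real powr_minus inverse_powr)
  finally show ?thesis .
next
  case zero
  then show ?thesis using assms by (simp add: pmean_def real_sqrt_mult real_sqrt_inverse)
qed (use assms in \<open>auto simp: pmean_def min_def max_def\<close>)

text \<open>Strict Bernoulli inequality: a strictly concave power lies below its tangent at \<open>1\<close>. With
  \<open>m\<close> for the right-hand side, a convex combination of \<open>1\<close> and \<open>z\<close>, it is the strict concavity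
  of \<open>ln\<close>, which follows from \<open>ln t \<le> t - 1\<close> at \<open>1 / m\<close> and \<open>z / m\<close>.\<close>

lemma powr_less_tangent:
  fixes z \<alpha> :: real
  assumes "0 < z" "z \<noteq> 1" "0 < \<alpha>" "\<alpha> < 1"
  shows "z powr \<alpha> < 1 + \<alpha> * (z - 1)"
proof -
  define m where "m = 1 + \<alpha> * (z - 1)"
  have m_eq: "m = (1 - \<alpha>) + \<alpha> * z" by (simp add: m_def algebra_simps)
  have m: "0 < m" using assms by (simp add: m_eq add_pos_pos)
  have "1 / m \<noteq> 1" using m assms by (simp add: m_def)
  then have "ln (1 / m) < 1 / m - 1"
    using ln_le_minus_one[of "1 / m"] ln_eq_minus_one[of "1 / m"] m by fastforce
  moreover have "ln (z / m) \<le> z / m - 1"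
    using ln_le_minus_one[of "z / m"] m assms by simp
  ultimately have "(1 - \<alpha>) * ln (1 / m) + \<alpha> * ln (z / m) < (1 - \<alpha>) * (1 / m - 1) + \<alpha> * (z / m - 1)"
    using assms by (intro add_less_le_mono mult_strict_left_mono mult_left_mono) auto
  also have "\<dots> = ((1 - \<alpha>) + \<alpha> * z) / m - 1"
    using m by (simp add: field_simps)
  also have "\<dots> = 0" using m by (simp add: m_eq[symmetric])
  finally have "\<alpha> * ln z < ln m"
    using m assms by (simp add: ln_div algebra_simps)
  then have "ln (z powr \<alpha>) < ln m" using assms by (simp add: ln_powr)
  then have "z powr \<alpha> < m" using m assms by (simp only: ln_less_cancel_iff powr_gt_zero)
  then show ?thesis by (simp add: m_def)
qed

text \<open>The tangent inequality is applied to \<open>u\<close> and \<open>w\<close> divided by their arithmetic mean, so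
  that the linear terms cancel.\<close>

lemma mean_powr_less:
  fixes u w \<alpha> :: real
  assumes "0 < u" "0 < w" "u \<noteq> w" "0 < \<alpha>" "\<alpha> < 1"
  shows "(u powr \<alpha> + w powr \<alpha>) / 2 < ((u + w) / 2) powr \<alpha>"
proof -
  define m where "m = (u + w) / 2"
  have m: "0 < m" using assms by (simp add: m_def)
  have "u / m \<noteq> 1" "w / m \<noteq> 1" using assms m by (auto simp: m_def field_simps)
  then have "(u / m) powr \<alpha> + (w / m) powr \<alpha> < (1 + \<alpha> * (u / m - 1)) + (1 + \<alpha> * (w / m - 1))"
    using assms m by (intro add_strict_mono powr_less_tangent) auto
  also have "\<dots> = 2 + \<alpha> * ((u + w) / m - 2)" by (simp add: algebra_simps add_divide_distrib)
  also have "(u + w) / m = 2" using m by (simp add: m_def divide_eq_eq)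
  finally have "(u powr \<alpha> + w powr \<alpha>) / m powr \<alpha> < 2"
    using assms m by (simp add: powr_divide add_divide_distrib)
  then show ?thesis using m by (simp add: m_def[symmetric] divide_less_eq)
qed

text \<open>Raising both means to a suitable positive power reduces finite \<open>q\<close> to the strict
  arithmetic-geometric mean inequality for \<open>p = 0\<close>, and to \<open>mean_powr_less\<close> with \<open>\<alpha> = p / q\<close>
  otherwise. For \<open>q = \<infinity>\<close> one of the two numbers is the maximum and the other is
  strictly smaller.\<close>

lemma pmean_strict_mono_nonneg:
  assumes "0 < x" "0 < y" "x \<noteq> y" "0 \<le> p" "p < q"
  shows "pmean p x y < pmean q x y"
proof -
  have powr_neq: "x powr r \<noteq> y powr r" if "r \<noteq> 0" for r
    using assms that by (metis less_imp_le powr_inj powr_powr powr_one_gt_zero_iff right_inverse)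
  have pos: "0 < x powr r + y powr r" for r
    using assms by (intro add_pos_pos) auto
  consider "p = 0" "q = \<infinity>" | s where "p = 0" "0 < s" "q = ereal s"
    | r where "0 < r" "p = ereal r" "q = \<infinity>"
    | r s where "0 < r" "r < s" "p = ereal r" "q = ereal s"
    using assms(4,5) by (cases p; cases q) (force simp: zero_ereal_def)+
  then show ?thesis
  proof cases
    case 1
    have "x * y < (max x y)\<^sup>2"
      using assms by (auto simp: max_def power2_eq_square)
    then show ?thesis using 1 assms
      by (simp add: pmean_def real_less_rsqrt
          real_sqrt_less_iff[of "x * y" "(max x y)\<^sup>2", symmetric] del: real_sqrt_less_iff)
  next
    case (2 s)
    define u where "u = x powr (s / 2)"
    define w where "w = y powr (s / 2)"
    have "u \<noteq> w" unfolding u_def w_def using powr_neq[of "s / 2"] 2 by simp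
    then have "0 < (u - w)\<^sup>2" by simp
    then have "u * w < (u\<^sup>2 + w\<^sup>2) / 2" by (simp add: power2_diff)
    moreover have "u\<^sup>2 = x powr s" "w\<^sup>2 = y powr s"
      unfolding u_def w_def using assms by (simp_all add: powr_power)
    moreover have "u * w = (x * y) powr (s / 2)"
      unfolding u_def w_def using assms by (simp add: powr_mult)
    ultimately have "(x * y) powr (s / 2) < (x powr s + y powr s) / 2" by simp
    then have "((x * y) powr (s / 2)) powr (1 / s) < ((x powr s + y powr s) / 2) powr (1 / s)"
      using 2 by (intro powr_less_mono2) auto
    then show ?thesis using 2 assms
      by (simp add: pmean_real powr_powr powr_half_sqrt) (simp add: pmean_def)
  next
    case (3 r)
    have "x powr r \<le> max x y powr r" "y powr r \<le> max x y powr r"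
      using assms 3 by (auto intro!: powr_mono2)
    then have "(x powr r + y powr r) / 2 < max x y powr r"
      using powr_neq[of r] 3 by (auto simp: field_simps)
    then have "((x powr r + y powr r) / 2) powr (1 / r) < (max x y powr r) powr (1 / r)"
      using 3 pos[of r] by (intro powr_less_mono2) auto
    then show ?thesis using 3 assms by (simp add: pmean_real powr_powr) (simp add: pmean_def)
  next
    case (4 r s)
    have "((x powr s) powr (r / s) + (y powr s) powr (r / s)) / 2
        < ((x powr s + y powr s) / 2) powr (r / s)"
      using assms 4 powr_neq[of s] by (intro mean_powr_less) auto
    then have "(x powr r + y powr r) / 2 < ((x powr s + y powr s) / 2) powr (r / s)"
      using 4 by (simp add: powr_powr)
    then have "((x powr r + y powr r) / 2) powr (1 / r)
        < (((x powr s + y powr s) / 2) powr (r / s)) powr (1 / r)"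
      using 4 pos[of r] by (intro powr_less_mono2) auto
    then show ?thesis using 4 by (simp add: pmean_real powr_powr)
  qed
qed

lemma pmean_strict_mono:
  assumes "0 < x" "0 < y" "x \<noteq> y" "p < q"
  shows "pmean p x y < pmean q x y"
proof -
  have nonpos: "pmean p' x y < pmean q' x y" if "p' < q'" "q' \<le> 0" for p' q'
  proof -
    have "pmean (- q') (inverse x) (inverse y) < pmean (- p') (inverse x) (inverse y)"
      using assms that by (intro pmean_strict_mono_nonneg) (auto simp: ereal_minus_less_minus)
    moreover have "0 < pmean (- q') (inverse x) (inverse y)"
      using assms by (intro pmean_pos) auto
    ultimately show ?thesis
      using pmean_uminus[of x y "- p'"] pmean_uminus[of x y "- q'"] assms
      by simp
  qed
  consider "0 \<le> p" | "q \<le> 0" | "p < 0" "0 < q" by fastforce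
  then show ?thesis
  proof cases
    case 3
    then show ?thesis
      using nonpos[of p 0] pmean_strict_mono_nonneg[of x y 0 q] assms by simp
  qed (use assms nonpos pmean_strict_mono_nonneg in auto)
qed

section \<open>Radial and support functions\<close>

definition radial_fun :: "(real ^ 'n) set \<Rightarrow> real ^ 'n \<Rightarrow> real" where
  "radial_fun C v = inverse (gauge_fun C v)"

text \<open>The infimum defining the gauge of \<open>v \<noteq> 0\<close> is attained, so its reciprocal is the largest
  multiple of \<open>v\<close> in \<open>C\<close>. Compactness of \<open>C\<close> gives the maximum, and \<open>0\<close> being an interior
  point makes it positive.\<close>

lemma radial_fun:
  fixes C :: "(real ^ 'n) set"
  assumes C: "C \<in> convex_bodies0" and v: "v \<noteq> 0"
  shows radial_fun_pos: "0 < radial_fun C v"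
    and radial_fun_mem: "radial_fun C v *\<^sub>R v \<in> C"
    and radial_fun_max: "t *\<^sub>R v \<in> C \<Longrightarrow> t \<le> radial_fun C v"
proof -
  have "compact C" "0 \<in> interior C" using C by (auto simp: convex_bodies0_def)
  then obtain B where B: "\<And>x. x \<in> C \<Longrightarrow> norm x \<le> B"
    by (meson bounded_iff compact_imp_bounded)
  define T where "T = {0..} \<inter> (\<lambda>t. t *\<^sub>R v) -` C"
  have "T \<subseteq> cball 0 (B / norm v)"
  proof
    fix t assume "t \<in> T"
    then have "t * norm v \<le> B" using B[of "t *\<^sub>R v"] by (simp add: T_def)
    then show "t \<in> cball 0 (B / norm v)" using v \<open>t \<in> T\<close> by (simp add: T_def pos_le_divide_eq)
  qed
  moreover have "closed T"
    unfolding T_def using \<open>compact C\<close>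
    by (intro closed_Int closed_atLeast closed_vimage compact_imp_closed continuous_intros)
  ultimately have "compact T"
    by (meson bounded_cball bounded_subset compact_eq_bounded_closed)
  moreover have "0 \<in> T"
    using \<open>0 \<in> interior C\<close> interior_subset by (auto simp: T_def)
  ultimately obtain m where m: "m \<in> T" "\<And>t. t \<in> T \<Longrightarrow> t \<le> m"
    using compact_attains_sup[of T] by blast
  obtain e where e: "0 < e" "ball 0 e \<subseteq> C"
    using \<open>0 \<in> interior C\<close> by (auto simp: mem_interior)
  then have "e / (2 * norm v) \<in> T"
    using v by (auto simp: T_def subset_iff)
  then have "0 < e / (2 * norm v)" "e / (2 * norm v) \<le> m" using e v m by auto
  then have mpos: "0 < m" by linarith
  have max: "t \<le> m" if "t *\<^sub>R v \<in> C" for t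
    using m(2)[of t] that mpos by (cases "0 \<le> t") (auto simp: T_def)
  have "gauge_fun C v = inverse m"
    unfolding gauge_fun_def
  proof (rule cInf_eq_minimum)
    have "v = inverse m *\<^sub>R (m *\<^sub>R v)" using mpos by simp
    moreover have "m *\<^sub>R v \<in> C" using m by (simp add: T_def)
    ultimately have "v \<in> (\<lambda>y. inverse m *\<^sub>R y) ` C" by (rule image_eqI)
    then show "inverse m \<in> {l. 0 \<le> l \<and> v \<in> (\<lambda>y. l *\<^sub>R y) ` C}"
      using mpos by simp
  next
    fix l assume "l \<in> {l. 0 \<le> l \<and> v \<in> (\<lambda>y. l *\<^sub>R y) ` C}"
    then obtain y where y: "0 \<le> l" "y \<in> C" "v = l *\<^sub>R y" by auto
    then have "0 < l" using v by (cases "l = 0") auto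
    then have "inverse l *\<^sub>R v = y" using y by simp
    then have "inverse l \<le> m" using max y by simp
    then show "inverse m \<le> l" using \<open>0 < l\<close>
      by (metis inverse_inverse_eq le_imp_inverse_le positive_imp_inverse_positive)
  qed
  then have eq: "radial_fun C v = m" by (simp add: radial_fun_def)
  show "0 < radial_fun C v" "radial_fun C v *\<^sub>R v \<in> C"
    "t *\<^sub>R v \<in> C \<Longrightarrow> t \<le> radial_fun C v"
    unfolding eq using mpos m max by (auto simp: T_def)
qed

lemma radial_fun_eqI:
  fixes C :: "(real ^ 'n) set"
  assumes "C \<in> convex_bodies0" "v \<noteq> 0" "m *\<^sub>R v \<in> C" "\<And>t. t *\<^sub>R v \<in> C \<Longrightarrow> t \<le> m"
  shows "radial_fun C v = m"
  using assms radial_fun_mem radial_fun_max by (metis order_antisym)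

lemma support_fun_ge:
  fixes C :: "(real ^ 'n) set"
  assumes "C \<in> convex_bodies0" "x \<in> C"
  shows "a \<bullet> x \<le> support_fun C a"
proof -
  have "compact ((\<lambda>x. a \<bullet> x) ` C)"
    using assms by (intro compact_continuous_image continuous_intros) (auto simp: convex_bodies0_def)
  then have "bdd_above ((\<lambda>x. a \<bullet> x) ` C)"
    by (intro bounded_imp_bdd_above compact_imp_bounded)
  then show ?thesis unfolding support_fun_def using assms(2) by (rule cSUP_upper2) simp
qed

lemma support_fun_eqI:
  fixes C :: "(real ^ 'n) set"
  assumes "x \<in> C" "\<And>y. y \<in> C \<Longrightarrow> a \<bullet> y \<le> a \<bullet> x"
  shows "support_fun C a = a \<bullet> x"
  unfolding support_fun_def using assms by (intro cSup_eq_maximum) auto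

lemma support_fun_pos:
  fixes C :: "(real ^ 'n) set"
  assumes "C \<in> convex_bodies0" "a \<noteq> 0"
  shows "0 < support_fun C a"
proof -
  have "0 < a \<bullet> (radial_fun C a *\<^sub>R a)" using radial_fun_pos[OF assms] assms by simp
  also have "\<dots> \<le> support_fun C a" using assms by (intro support_fun_ge radial_fun_mem)
  finally show ?thesis .
qed

lemma scale_mem_interior:
  fixes C :: "(real ^ 'n) set"
  assumes "C \<in> convex_bodies0" "x \<in> C" "0 \<le> t" "t < 1"
  shows "t *\<^sub>R x \<in> interior C"
  using mem_interior_convex_shrink[of C 0 x "1 - t"] assms
  by (simp add: convex_bodies0_def algebra_simps)

lemma scale_mem:
  fixes C :: "(real ^ 'n) set"
  assumes "C \<in> convex_bodies0" "x \<in> C" "0 \<le> t" "t \<le> 1"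
  shows "t *\<^sub>R x \<in> C"
  using scale_mem_interior[of C x t] assms interior_subset by (cases "t = 1") auto

lemma radial_point_frontier:
  fixes C :: "(real ^ 'n) set"
  assumes C: "C \<in> convex_bodies0" and v: "v \<noteq> 0"
  shows "radial_fun C v *\<^sub>R v \<in> frontier C"
proof -
  let ?r = "radial_fun C v"
  have "?r *\<^sub>R v \<notin> interior C"
  proof
    assume "?r *\<^sub>R v \<in> interior C"
    then obtain e where e: "0 < e" "cball (?r *\<^sub>R v) e \<subseteq> C" by (auto simp: mem_interior_cball)
    have "(?r + e / norm v) *\<^sub>R v \<in> cball (?r *\<^sub>R v) e"
      using e v by (simp add: dist_norm algebra_simps)
    then have "?r + e / norm v \<le> ?r" using e radial_fun_max[OF C v] by blast
    then show False using e v by (simp add: divide_le_0_iff)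
  qed
  then show ?thesis
    using radial_fun_mem[OF C v] closure_subset by (auto simp: frontier_def)
qed

text \<open>Beyond a boundary point the ray from \<open>0\<close> leaves \<open>C\<close>: otherwise the point would be a proper
  shrinking of a point of \<open>C\<close> towards the interior point \<open>0\<close>.\<close>

lemma frontier_ray_le_1:
  fixes C :: "(real ^ 'n) set"
  assumes C: "C \<in> convex_bodies0" and k: "k \<in> frontier C" and t: "t *\<^sub>R k \<in> C"
  shows "t \<le> 1"
proof (rule ccontr)
  assume "\<not> t \<le> 1"
  then have "inverse t *\<^sub>R t *\<^sub>R k \<in> interior C"
    using C t by (intro scale_mem_interior) (auto simp: field_simps)
  then show False using \<open>\<not> t \<le> 1\<close> k by (simp add: frontier_def)
qed

section \<open>Separating the lower from the upper mean\<close>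

text \<open>The factor \<open>R\<close> is the maximum of all \<open>s\<close> such that \<open>s k\<close> is in \<open>L\<close> for some boundary point
  \<open>k\<close> of \<open>K\<close>; it exists because the pairs \<open>(s, k)\<close> form a compact set. It exceeds \<open>1\<close> because
  a point of \<open>L\<close> outside \<open>K\<close> lies beyond the boundary point of \<open>K\<close> on its ray.\<close>

lemma touching_dilation:
  fixes K L :: "(real ^ 'n) set"
  assumes K: "K \<in> convex_bodies0" and L: "L \<in> convex_bodies0" and nsub: "\<not> L \<subseteq> K"
  obtains R k where "1 < R" "k \<in> frontier K" "R *\<^sub>R k \<in> L" "\<And>y. y \<in> L \<Longrightarrow> inverse R *\<^sub>R y \<in> K"
proof -
  have cK: "compact K" "0 \<in> interior K" and cL: "compact L"
    using K L by (auto simp: convex_bodies0_def)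
  obtain B where B: "\<And>x. x \<in> L \<Longrightarrow> norm x \<le> B"
    using cL by (meson bounded_iff compact_imp_bounded)
  obtain e where e: "0 < e" "ball 0 e \<subseteq> interior K"
    using cK(2) open_contains_ball open_interior by blast
  \<comment> \<open>Boundary points of \<open>K\<close> have norm at least \<open>e\<close>, so the bound \<open>B / e\<close> excludes no pair.\<close>
  define P where "P = ({0..B / e} \<times> frontier K) \<inter> (\<lambda>(s, k). s *\<^sub>R k) -` L"
  have memP: "(s, k) \<in> P" if "0 \<le> s" "k \<in> frontier K" "s *\<^sub>R k \<in> L" for s k
  proof -
    have "k \<notin> ball 0 e" using e that by (auto simp: frontier_def)
    then have "s * e \<le> s * norm k" using that by (intro mult_left_mono) auto
    also have "\<dots> \<le> B" using B[OF that(3)] that by simp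
    finally show ?thesis using that e by (simp add: P_def field_simps)
  qed
  have ray: "(inverse (radial_fun K y), radial_fun K y *\<^sub>R y) \<in> P" if "y \<in> L" "y \<noteq> 0" for y
    using that radial_fun_pos[OF K that(2)] radial_point_frontier[OF K that(2)]
    by (intro memP) auto
  have "compact P"
    unfolding P_def using cK cL
    by (intro compact_Int_closed compact_Times compact_frontier closed_vimage compact_imp_closed)
       (auto simp: case_prod_unfold intro!: continuous_intros)
  moreover obtain y0 where y0: "y0 \<in> L" "y0 \<notin> K" using nsub by blast
  then have "y0 \<noteq> 0" using cK interior_subset by blast
  with ray y0 have "P \<noteq> {}" by blast
  moreover have "continuous_on P fst" by (intro continuous_intros)
  ultimately obtain z where z: "z \<in> P" "\<And>z'. z' \<in> P \<Longrightarrow> fst z' \<le> fst z"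
    using continuous_attains_sup[of P fst] by blast
  obtain R k where Rk: "z = (R, k)" by (cases z)
  have "radial_fun K y0 < 1"
  proof (rule ccontr)
    assume "\<not> ?thesis"
    then have "1 \<le> radial_fun K y0" by simp
    then have "inverse (radial_fun K y0) *\<^sub>R (radial_fun K y0 *\<^sub>R y0) \<in> K"
      by (intro scale_mem[OF K radial_fun_mem[OF K \<open>y0 \<noteq> 0\<close>]] inverse_le_1_iff[THEN iffD2]) auto
    moreover have "inverse (radial_fun K y0) *\<^sub>R (radial_fun K y0 *\<^sub>R y0) = y0"
      using \<open>1 \<le> radial_fun K y0\<close> by simp
    ultimately show False using y0 by simp
  qed
  then have "1 < inverse (radial_fun K y0)"
    using radial_fun_pos[OF K \<open>y0 \<noteq> 0\<close>] by (rule one_less_inverse[rotated])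
  also have "\<dots> \<le> R" using z(2)[OF ray[OF y0(1) \<open>y0 \<noteq> 0\<close>]] Rk by simp
  finally have R: "1 < R" .
  show thesis
  proof (rule that[OF R])
    show "k \<in> frontier K" "R *\<^sub>R k \<in> L" using z Rk by (auto simp: P_def)
  next
    fix y assume y: "y \<in> L"
    show "inverse R *\<^sub>R y \<in> K"
    proof (cases "y = 0")
      case True
      then show ?thesis using cK interior_subset by auto
    next
      case False
      have "inverse (radial_fun K y) \<le> R" using z(2)[OF ray[OF y False]] Rk by simp
      then have "inverse R \<le> radial_fun K y"
        using R radial_fun_pos[OF K False]
        by (metis inverse_inverse_eq le_imp_inverse_le positive_imp_inverse_positive)
      then have "(inverse R / radial_fun K y) *\<^sub>R (radial_fun K y *\<^sub>R y) \<in> K"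
        using R radial_fun_pos[OF K False]
        by (intro scale_mem[OF K radial_fun_mem[OF K False]]) (simp_all add: pos_divide_le_eq)
      then show ?thesis using radial_fun_pos[OF K False] by simp
    qed
  qed
qed

text \<open>The separating point and halfspace come from the touching point of \<open>L\<close> and the smallest
  dilate \<open>R K\<close> containing \<open>L\<close>: there both the radial and the support function of \<open>L\<close> are \<open>R\<close> times
  those of \<open>K\<close>, so that homogeneity reduces the claim to the strict inequality between \<open>m\<^sub>p\<close> and
  \<open>m\<^sub>q\<close>.\<close>

lemma lower_mean_not_subset_if_not_subset:
  fixes K L :: "(real ^ 'n) set"
  assumes K: "K \<in> convex_bodies0" and L: "L \<in> convex_bodies0" and nsub: "\<not> L \<subseteq> K" and pq: "p < q"
  shows "\<not> lower_mean q K L \<subseteq> upper_mean p K L"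
proof -
  obtain R k where R: "1 < R" and k: "k \<in> frontier K" and RkL: "R *\<^sub>R k \<in> L"
    and LRK: "\<And>y. y \<in> L \<Longrightarrow> inverse R *\<^sub>R y \<in> K"
    using touching_dilation[OF K L nsub] by blast
  have "compact K" "convex K" and intK: "0 \<in> interior K" using K by (auto simp: convex_bodies0_def)
  then have clK: "closure K = K" by (simp add: compact_imp_closed)
  have kK: "k \<in> K" "k \<notin> interior K" using k clK by (auto simp: frontier_def)
  have k0: "k \<noteq> 0" using kK intK by auto
  have "rel_interior K = interior K" using intK by (intro rel_interior_nonempty_interior) auto
  then obtain b where b: "b \<noteq> 0" "\<And>y. y \<in> K \<Longrightarrow> b \<bullet> k \<le> b \<bullet> y"
    using supporting_hyperplane_relative_frontier[OF \<open>convex K\<close>, of k] kK clK by metis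
  define a where "a = - (inverse (norm b) *\<^sub>R b)"
  have a: "norm a = 1" "a \<noteq> 0" using b by (auto simp: a_def)
  have ak: "a \<bullet> y \<le> a \<bullet> k" if "y \<in> K" for y
    using b that by (simp add: a_def mult_left_mono)
  have hK: "support_fun K a = a \<bullet> k" using kK ak by (intro support_fun_eqI)
  then have akpos: "0 < a \<bullet> k" using support_fun_pos[OF K a(2)] by simp
  have "support_fun L a = a \<bullet> (R *\<^sub>R k)"
  proof (rule support_fun_eqI[OF RkL])
    fix y assume "y \<in> L"
    then have "a \<bullet> (inverse R *\<^sub>R y) \<le> a \<bullet> k" by (intro ak LRK)
    then show "a \<bullet> y \<le> a \<bullet> (R *\<^sub>R k)" using R by (simp add: field_simps)
  qed
  then have hL: "support_fun L a = R * (a \<bullet> k)" by simp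
  define v where "v = inverse (norm k) *\<^sub>R k"
  have v: "norm v = 1" "v \<noteq> 0" using k0 by (auto simp: v_def)
  have rK: "radial_fun K v = norm k"
  proof (rule radial_fun_eqI[OF K v(2)])
    show "norm k *\<^sub>R v \<in> K" using k0 kK by (simp add: v_def)
  next
    fix t assume "t *\<^sub>R v \<in> K"
    then have "(t / norm k) *\<^sub>R k \<in> K" by (simp add: v_def divide_inverse)
    then show "t \<le> norm k" using frontier_ray_le_1[OF K k] k0 by (fastforce simp: field_simps)
  qed
  have rL: "radial_fun L v = R * norm k"
  proof (rule radial_fun_eqI[OF L v(2)])
    have "(R * norm k) *\<^sub>R v = R *\<^sub>R k" using k0 by (simp add: v_def)
    then show "(R * norm k) *\<^sub>R v \<in> L" using RkL by simp
  next
    fix t assume "t *\<^sub>R v \<in> L"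
    then have "inverse R *\<^sub>R t *\<^sub>R v \<in> K" by (rule LRK)
    then have "(t / (R * norm k)) *\<^sub>R k \<in> K" by (simp add: v_def divide_inverse mult_ac)
    then have "t / (R * norm k) \<le> 1" by (rule frontier_ray_le_1[OF K k])
    then show "t \<le> R * norm k" using R k0 by (simp add: divide_le_eq)
  qed
  define x where "x = pmean q (radial_fun K v) (radial_fun L v) *\<^sub>R v"
  have "x \<in> lower_mean q K L"
    unfolding lower_mean_def[folded radial_fun_def] x_def using v by (intro hull_inc imageI) simp
  moreover have "x \<notin> upper_mean p K L"
  proof
    assume "x \<in> upper_mean p K L"
    then have "a \<bullet> x \<le> pmean p (support_fun K a) (support_fun L a)"
      using a by (simp add: upper_mean_def)
    also have "\<dots> = pmean p (a \<bullet> k) (R * (a \<bullet> k))" by (simp only: hK hL)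
    also have "\<dots> < pmean q (a \<bullet> k) (R * (a \<bullet> k))"
      using pq akpos R by (intro pmean_strict_mono) auto
    also have "a \<bullet> k = (a \<bullet> v) * norm k"
      using k0 by (simp add: v_def)
    also have "R * ((a \<bullet> v) * norm k) = (a \<bullet> v) * (R * norm k)"
      by (simp only: mult.left_commute)
    also have "pmean q ((a \<bullet> v) * norm k) ((a \<bullet> v) * (R * norm k))
        = (a \<bullet> v) * pmean q (norm k) (R * norm k)"
      using k0 R akpos by (intro pmean_scale) (auto simp: v_def)
    also have "\<dots> = a \<bullet> x" by (simp add: x_def rK rL mult.commute)
    finally show False by simp
  qed
  ultimately show ?thesis by blast
qed

lemma lower_mean_commute: "lower_mean p K L = lower_mean p L K"
  unfolding lower_mean_def[folded radial_fun_def] by (subst pmean_commute) simp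

lemma upper_mean_commute: "upper_mean p K L = upper_mean p L K"
  unfolding upper_mean_def by (subst pmean_commute) simp

lemma lower_mean_not_subset:
  fixes K L :: "(real ^ 'n) set"
  assumes "K \<in> convex_bodies0" "L \<in> convex_bodies0" "K \<noteq> L" "p < q"
  shows "\<not> lower_mean q K L \<subseteq> upper_mean p K L"
proof (cases "L \<subseteq> K")
  case False
  then show ?thesis using assms by (intro lower_mean_not_subset_if_not_subset)
next
  case True
  then have "\<not> K \<subseteq> L" using assms by blast
  then have "\<not> lower_mean q L K \<subseteq> upper_mean p L K"
    using assms by (intro lower_mean_not_subset_if_not_subset)
  then show ?thesis
    by (simp only: lower_mean_commute[of q K L] upper_mean_commute[of p K L] not_False_eq_True)
qed

section \<open>Inclusions between the means\<close>

lemma convex_upper_mean: "convex (upper_mean p K L)"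
proof -
  have "upper_mean p K L =
      (\<Inter>a\<in>sphere 0 1. {x. a \<bullet> x \<le> pmean p (support_fun K a) (support_fun L a)})"
    by (auto simp: upper_mean_def)
  then show ?thesis by (simp add: convex_INT convex_halfspace_le)
qed

text \<open>If \<open>a \<bullet> v > 0\<close>, then \<open>(a \<bullet> v) \<rho>\<^sub>C(v) \<le> h\<^sub>C(a)\<close> for both bodies, and homogeneity and
  monotonicity of the power mean carry this over to the means. Otherwise the left-hand side is
  nonpositive and the right-hand side positive.\<close>

lemma lower_mean_subset_upper_mean:
  fixes K L :: "(real ^ 'n) set"
  assumes K: "K \<in> convex_bodies0" and L: "L \<in> convex_bodies0"
  shows "lower_mean p K L \<subseteq> upper_mean p K L"
  unfolding lower_mean_def[folded radial_fun_def]
proof (intro hull_minimal convex_upper_mean image_subsetI)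
  fix v :: "real ^ 'n" assume "v \<in> sphere 0 1"
  then have v: "v \<noteq> 0" by auto
  let ?m = "pmean p (radial_fun K v) (radial_fun L v)"
  show "?m *\<^sub>R v \<in> upper_mean p K L"
    unfolding upper_mean_def
  proof (intro CollectI ballI)
    fix a :: "real ^ 'n" assume "a \<in> sphere 0 1"
    then have a: "a \<noteq> 0" by auto
    have h: "0 < support_fun K a" "0 < support_fun L a"
      using support_fun_pos K L a by auto
    show "a \<bullet> (?m *\<^sub>R v) \<le> pmean p (support_fun K a) (support_fun L a)"
    proof (cases "0 < a \<bullet> v")
      case True
      have *: "(a \<bullet> v) * radial_fun C v \<le> support_fun C a" if "C \<in> convex_bodies0" for C
        using support_fun_ge[OF that radial_fun_mem[OF that v], of a] by (simp add: mult.commute)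
      have "a \<bullet> (?m *\<^sub>R v) = pmean p ((a \<bullet> v) * radial_fun K v) ((a \<bullet> v) * radial_fun L v)"
        using True radial_fun_pos[OF K v] radial_fun_pos[OF L v] by (subst pmean_scale) auto
      also have "\<dots> \<le> pmean p (support_fun K a) (support_fun L a)"
        using True radial_fun_pos[OF K v] radial_fun_pos[OF L v] *[OF K] *[OF L]
        by (intro pmean_mono mult_pos_pos)
      finally show ?thesis .
    next
      case False
      then have "a \<bullet> (?m *\<^sub>R v) \<le> 0"
        using pmean_pos[OF radial_fun_pos[OF K v] radial_fun_pos[OF L v], of p]
        by (simp add: mult_nonneg_nonpos)
      also have "\<dots> \<le> pmean p (support_fun K a) (support_fun L a)"
        using pmean_pos[OF h] by (rule less_imp_le)
      finally show ?thesis .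
    qed
  qed
qed

text \<open>The defining inequalities reduce to those of the supporting halfspaces of \<open>K\<close>, whose
  intersection is \<open>K\<close> by separation.\<close>

lemma upper_mean_same_subset:
  fixes K :: "(real ^ 'n) set"
  assumes K: "K \<in> convex_bodies0"
  shows "upper_mean p K K \<subseteq> K"
proof
  fix x assume x: "x \<in> upper_mean p K K"
  show "x \<in> K"
  proof (rule ccontr)
    assume "x \<notin> K"
    have "compact K" "convex K" "0 \<in> K" using K interior_subset by (auto simp: convex_bodies0_def)
    then obtain b c where bc: "b \<bullet> x < c" "\<And>y. y \<in> K \<Longrightarrow> c < b \<bullet> y"
      using separating_hyperplane_closed_point[of K x] \<open>x \<notin> K\<close> compact_imp_closed by metis
    then have "b \<noteq> 0" using bc(2)[OF \<open>0 \<in> K\<close>] by auto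
    define a where "a = - (inverse (norm b) *\<^sub>R b)"
    have a: "norm a = 1" "a \<noteq> 0" using \<open>b \<noteq> 0\<close> by (auto simp: a_def)
    have "support_fun K a \<le> - (inverse (norm b) * c)"
      unfolding support_fun_def
    proof (rule cSUP_least)
      show "K \<noteq> {}" using \<open>0 \<in> K\<close> by blast
      fix y assume "y \<in> K"
      then show "a \<bullet> y \<le> - (inverse (norm b) * c)"
        using bc(2)[of y] by (simp add: a_def mult_left_mono)
    qed
    also have "\<dots> < a \<bullet> x" using bc(1) \<open>b \<noteq> 0\<close> by (simp add: a_def)
    also have "\<dots> \<le> pmean p (support_fun K a) (support_fun K a)"
      using x a by (simp add: upper_mean_def)
    also have "\<dots> = support_fun K a" using K a by (intro pmean_same support_fun_pos)
    finally show False by simp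
  qed
qed

text \<open>The generators are now the boundary points of \<open>K\<close> on the rays from \<open>0\<close>; every point of \<open>K\<close>
  lies on a chord between two opposite ones.\<close>

lemma subset_lower_mean_same:
  fixes K :: "(real ^ 'n) set"
  assumes K: "K \<in> convex_bodies0"
  shows "K \<subseteq> lower_mean p K K"
proof
  fix x assume x: "x \<in> K"
  have mem: "radial_fun K v *\<^sub>R v \<in> lower_mean p K K" if "norm v = 1" for v
  proof -
    have "v \<noteq> 0" using that by auto
    then have "radial_fun K v *\<^sub>R v = pmean p (radial_fun K v) (radial_fun K v) *\<^sub>R v"
      using pmean_same radial_fun_pos[OF K] by metis
    then show ?thesis
      unfolding lower_mean_def[folded radial_fun_def] using that
      by (intro hull_inc) (auto simp only: image_iff mem_sphere_0)
  qed
  have seg: "t *\<^sub>R v \<in> lower_mean p K K"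
    if v: "norm v = 1" and t: "0 \<le> t" "t \<le> radial_fun K v" for v t
  proof -
    have "v \<noteq> 0" using v by auto
    then have pos: "0 < radial_fun K v" "0 < radial_fun K (- v)"
      using radial_fun_pos[OF K, of v] radial_fun_pos[OF K, of "- v"] by auto
    let ?r = "radial_fun K v" and ?s = "radial_fun K (- v)"
    \<comment> \<open>The weight that places \<open>t v\<close> on the chord from \<open>- ?s v\<close> to \<open>?r v\<close>.\<close>
    define u where "u = (t + ?s) / (?r + ?s)"
    have u: "0 \<le> u" "u \<le> 1" using t pos by (auto simp: u_def)
    have "u * ?r - (1 - u) * ?s = u * (?r + ?s) - ?s" by (simp add: algebra_simps)
    also have "\<dots> = t" using pos by (simp add: u_def)
    finally have "u *\<^sub>R (?r *\<^sub>R v) + (1 - u) *\<^sub>R (?s *\<^sub>R (- v)) = t *\<^sub>R v"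
      by (metis scaleR_left_diff_distrib scaleR_minus_right scaleR_scaleR uminus_add_conv_diff add.commute)
    moreover have "u *\<^sub>R (?r *\<^sub>R v) + (1 - u) *\<^sub>R (?s *\<^sub>R (- v)) \<in> lower_mean p K K"
      using u v mem[of v] mem[of "- v"] convex_convex_hull
      by (intro convexD) (auto simp: lower_mean_def[folded radial_fun_def])
    ultimately show ?thesis by simp
  qed
  show "x \<in> lower_mean p K K"
  proof (cases "x = 0")
    case True
    obtain v :: "real ^ 'n" where "norm v = 1" using vector_choose_size[of 1] by auto
    moreover then have "v \<noteq> 0" by auto
    ultimately show ?thesis using seg[of v 0] radial_fun_pos[OF K, of v] True by simp
  next
    case False
    define v where "v = inverse (norm x) *\<^sub>R x"
    have v: "norm v = 1" "norm x *\<^sub>R v = x" using False by (auto simp: v_def)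
    then have "norm x \<le> radial_fun K v" using x by (intro radial_fun_max[OF K]) auto
    then show ?thesis using seg[of v "norm x"] v by simp
  qed
qed

theorem theorem5p3:
  fixes K L :: "(real ^ 'n) set"
    and p q :: ereal
    and Mp Mq :: "(real ^ 'n) set \<Rightarrow> (real ^ 'n) set \<Rightarrow> (real ^ 'n) set"
  assumes "K \<in> convex_bodies0" and "L \<in> convex_bodies0"
    and "p < q"
    and "Mp \<in> {upper_mean p, lower_mean p}"
    and "Mq \<in> {upper_mean q, lower_mean q}"
  shows "Mp K L = Mq K L \<longleftrightarrow> K = L"
proof
  assume eq: "Mp K L = Mq K L"
  have "lower_mean q K L \<subseteq> Mq K L"
    using assms lower_mean_subset_upper_mean by blast
  also have "\<dots> = Mp K L" using eq ..
  also have "\<dots> \<subseteq> upper_mean p K L"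
    using assms lower_mean_subset_upper_mean by blast
  finally show "K = L" using lower_mean_not_subset assms by blast
next
  assume "K = L"
  have "upper_mean r K K = K" "lower_mean r K K = K" for r
    using subset_lower_mean_same[OF assms(1), of r] upper_mean_same_subset[OF assms(1), of r]
      lower_mean_subset_upper_mean[OF assms(1) assms(1), of r] by auto
  then show "Mp K L = Mq K L" using assms \<open>K = L\<close> by auto
qed

end
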